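(* For any loopless digraph $D$ without in-universal vertices, \[ \frac{1}{\gamma^{in}_f(D)} + \frac{1}{\Gamma^{out}_f(\overline{D})} = 1. \]
   Context: A loopless digraph $D$ has a finite vertex set $V(D)$ and arc set $E(D) \subseteq V(D)^2 \setminus \{(v,v)\}$. Its complement $\overline{D}$ has vertex set $V(D)$ and arc set $V(D)^2 \setminus (\{(v,v): v\in V(D)\} \cup E(D))$. For $v\in V(D)$: the open in-neighbourhood is $N^{in}_o(v) = \{u : (u,v)\in E(D)\}$, the closed in-neighbourhood is $N^{in}_c(v) = N^{in}_o(v)\cup\{v\}$, the open out-neighbourhood is $N^{out}_o(v) = \{u : (v,u) \in E(D)\}$. For a hypergraph $H=(V,E)$ (finite vertex set, multiset of edges), the fractional transversal number $\tau_f(H)$ is the optimal value of $\min\sum_{v} x_v$ s.t. $\sum_{v \in e} x_v \ge 1$ for all $e\in E$, $x\ge 0$. The fractional in-dominating number is $\gamma^{in}_f(D) = \tau_f(H)$ where $H$ has vertex set $V(D)$ and edges the closed in-neighbourhoods $N^{in}_c(v)$, $v \in V(D)$. The fractional total out-dominating number is $\Gamma^{out}_f(D) = \tau_f(H')$ where $H'$ has vertex set $V(D)$ and edges the open out-neighbourhoods $N^{out}_o(v)$, $v\in V(D)$. A vertex $v$ is in-universal in $D$ if $v \in N^{in}_c(u)$ for all $u\in V(D)$. *)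

theory Defs
  imports Complex_Main "HOL-Library.Multiset" "Graph_Theory.Pair_Digraph"
begin

definition complement_digraph :: "'a pair_pre_digraph \<Rightarrow> 'a pair_pre_digraph" where
  "complement_digraph D =
     \<lparr> pverts = pverts D,
       parcs = pverts D \<times> pverts D - ({(v, v) | v. v \<in> pverts D} \<union> parcs D) \<rparr>"

definition open_in_nbhd :: "'a pair_pre_digraph \<Rightarrow> 'a \<Rightarrow> 'a set" where
  "open_in_nbhd D v = {u. (u, v) \<in> parcs D}"

definition closed_in_nbhd :: "'a pair_pre_digraph \<Rightarrow> 'a \<Rightarrow> 'a set" where
  "closed_in_nbhd D v = open_in_nbhd D v \<union> {v}"

definition open_out_nbhd :: "'a pair_pre_digraph \<Rightarrow> 'a \<Rightarrow> 'a set" where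
  "open_out_nbhd D v = {u. (v, u) \<in> parcs D}"

definition in_universal :: "'a pair_pre_digraph \<Rightarrow> 'a \<Rightarrow> bool" where
  "in_universal D v \<longleftrightarrow> v \<in> pverts D \<and> (\<forall>u\<in>pverts D. v \<in> closed_in_nbhd D u)"

definition fractional_transversals :: "'a set \<Rightarrow> 'a set multiset \<Rightarrow> ('a \<Rightarrow> real) set" where
  "fractional_transversals V E =
     {x. (\<forall>v\<in>V. 0 \<le> x v) \<and> (\<forall>e\<in>#E. 1 \<le> (\<Sum>v\<in>e. x v))}"

(* If V is finite and every edge is a nonempty subset of V, the program is feasible and the
   infimum is a minimum. If some edge is empty, the program is infeasible and the value below
   is the unspecified real Inf {}. *)
definition fractional_transversal_number :: "'a set \<Rightarrow> 'a set multiset \<Rightarrow> real" where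
  "fractional_transversal_number V E = Inf ((\<lambda>x. \<Sum>v\<in>V. x v) ` fractional_transversals V E)"

definition fractional_in_dominating_number :: "'a pair_pre_digraph \<Rightarrow> real" where
  "fractional_in_dominating_number D =
     fractional_transversal_number (pverts D) (image_mset (closed_in_nbhd D) (mset_set (pverts D)))"

(* An out-neighbourhood in the complement of a digraph is empty precisely at an in-universal
   vertex of that digraph, so the complement of a digraph without in-universal vertices gives
   a feasible program here. *)
definition fractional_total_out_dominating_number :: "'a pair_pre_digraph \<Rightarrow> real" where
  "fractional_total_out_dominating_number D =
     fractional_transversal_number (pverts D) (image_mset (open_out_nbhd D) (mset_set (pverts D)))"

end

theory Submission
  imports Defs
begin

text \<open>
  After normalising transversals to probability vectors, the reciprocal of a fractional
  transversal number is the value of the zero-sum game whose matrix is the incidence matrix of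
  the hypergraph. A vertex \<open>u\<close> lies in the out-neighbourhood of \<open>v\<close> in the complement of \<open>D\<close> iff
  \<open>v\<close> does not lie in the closed in-neighbourhood of \<open>u\<close> in \<open>D\<close>, so the two matrices are \<open>M\<close> and
  \<open>J - M\<^sup>T\<close> with \<open>J\<close> the all-ones matrix, and the minimax theorem makes their values add up to \<open>1\<close>.
  Only an approximate minimax theorem is needed, since the transversal number is an infimum; it
  is obtained from Blackwell's approachability strategy.
\<close>

section \<open>Approachability and approximate minimax\<close>

lemma max_zero_add_square_le:
  fixes a b :: real
  shows "(max 0 (a + b))\<^sup>2 \<le> (max 0 a)\<^sup>2 + 2 * (max 0 a * b) + b\<^sup>2"
proof -
  have "(max 0 (a + b))\<^sup>2 \<le> (max 0 a + b)\<^sup>2"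
    by (rule abs_le_square_iff[THEN iffD1]) (auto simp: max_def)
  also have "\<dots> = (max 0 a)\<^sup>2 + 2 * (max 0 a * b) + b\<^sup>2"
    by (simp add: power2_sum)
  finally show ?thesis .
qed

text \<open>Here \<open>x w\<close> counts the rounds in which column \<open>w\<close> is played,
  and the left-hand sum is the squared distance of the accumulated payoff from the orthant of
  payoffs at least \<open>c * n\<close>. Since it grows only linearly in \<open>n\<close>, the
  average shortfall per round tends to 0.\<close>

lemma blackwell_approach:
  fixes A :: "'a \<Rightarrow> 'b \<Rightarrow> real" and c :: real and n :: nat
  assumes "finite V" "finite W"
    and response: "\<forall>y. (\<forall>v\<in>V. 0 \<le> y v) \<longrightarrow> (\<exists>w\<in>W. c * sum y V \<le> (\<Sum>v\<in>V. y v * A v w))"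
  shows "\<exists>x. (\<forall>w\<in>W. 0 \<le> x w) \<and> sum x W = real n \<and>
    (\<Sum>v\<in>V. (max 0 (c * real n - (\<Sum>w\<in>W. A v w * x w)))\<^sup>2)
      \<le> real n * (\<Sum>v\<in>V. \<Sum>w\<in>W. (c - A v w)\<^sup>2)"
proof (induction n)
  case 0
  show ?case by (rule exI[of _ "\<lambda>_. 0"]) simp
next
  case (Suc n)
  define K where "K = (\<Sum>v\<in>V. \<Sum>w\<in>W. (c - A v w)\<^sup>2)"
  obtain x where x: "\<forall>w\<in>W. 0 \<le> x w" "sum x W = real n"
    and bound: "(\<Sum>v\<in>V. (max 0 (c * real n - (\<Sum>w\<in>W. A v w * x w)))\<^sup>2) \<le> real n * K"
    using Suc.IH unfolding K_def by blast
  define r where "r v = c * real n - (\<Sum>w\<in>W. A v w * x w)" for v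
  \<comment> \<open>Play a response to the weights given by the positive parts of the current
    shortfalls \<open>r v\<close>; this makes the cross term of the expanded square
    nonpositive.\<close>
  obtain u where u: "u \<in> W"
    "c * (\<Sum>v\<in>V. max 0 (r v)) \<le> (\<Sum>v\<in>V. max 0 (r v) * A v u)"
    using response[THEN spec, of "\<lambda>v. max 0 (r v)"] by auto
  define x' where "x' w = x w + (if w = u then 1 else 0)" for w
  have sum_x': "sum x' W = real (Suc n)"
    using u x \<open>finite W\<close> by (simp add: x'_def sum.distrib)
  have Ax': "c * real (Suc n) - (\<Sum>w\<in>W. A v w * x' w) = r v + (c - A v u)" for v
  proof -
    have "(\<Sum>w\<in>W. A v w * x' w) = (\<Sum>w\<in>W. A v w * x w + (if w = u then A v w else 0))"
      by (intro sum.cong) (auto simp: x'_def distrib_left)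
    then show ?thesis
      using u \<open>finite W\<close> by (simp add: r_def sum.distrib algebra_simps)
  qed
  have cross: "(\<Sum>v\<in>V. max 0 (r v) * (c - A v u)) \<le> 0"
    using u(2) by (simp add: right_diff_distrib sum_subtractf sum_distrib_left mult.commute)
  have "(\<Sum>v\<in>V. (max 0 (r v + (c - A v u)))\<^sup>2)
      \<le> (\<Sum>v\<in>V. (max 0 (r v))\<^sup>2 + 2 * (max 0 (r v) * (c - A v u)) + (c - A v u)\<^sup>2)"
    by (intro sum_mono max_zero_add_square_le)
  also have "\<dots> = (\<Sum>v\<in>V. (max 0 (r v))\<^sup>2) + 2 * (\<Sum>v\<in>V. max 0 (r v) * (c - A v u))
      + (\<Sum>v\<in>V. (c - A v u)\<^sup>2)"
    by (simp add: sum.distrib sum_distrib_left)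
  also have "\<dots> \<le> real n * K + (\<Sum>v\<in>V. (c - A v u)\<^sup>2)"
    using bound cross by (simp add: r_def)
  \<comment> \<open>\<open>K\<close> sums over all columns, so the increment is bounded
    independently of the round.\<close>
  also have "(\<Sum>v\<in>V. (c - A v u)\<^sup>2) \<le> K"
    unfolding K_def using u(1) \<open>finite W\<close> by (intro sum_mono member_le_sum) auto
  finally have "(\<Sum>v\<in>V. (max 0 (r v + (c - A v u)))\<^sup>2) \<le> real (Suc n) * K"
    by (simp add: algebra_simps)
  moreover have "\<forall>w\<in>W. 0 \<le> x' w"
    using x by (auto simp: x'_def)
  ultimately show ?case
    using sum_x' Ax' unfolding K_def by (intro exI[of _ x']) simp
qed

lemma approximate_minimax:
  fixes A :: "'a \<Rightarrow> 'b \<Rightarrow> real" and c d :: real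
  assumes "finite V" "finite W"
    and response: "\<forall>y. (\<forall>v\<in>V. 0 \<le> y v) \<longrightarrow> (\<exists>w\<in>W. c * sum y V \<le> (\<Sum>v\<in>V. y v * A v w))"
    and "d < c"
  shows "\<exists>x. (\<forall>w\<in>W. 0 \<le> x w) \<and> sum x W = 1 \<and> (\<forall>v\<in>V. d \<le> (\<Sum>w\<in>W. A v w * x w))"
proof -
  define K where "K = (\<Sum>v\<in>V. \<Sum>w\<in>W. (c - A v w)\<^sup>2)"
  have pos: "(c - d)\<^sup>2 > 0" using \<open>d < c\<close> by simp
  \<comment> \<open>With this \<open>n\<close>, the squared-distance bound \<open>n * K\<close> is
    at most \<open>(n * (c - d))\<^sup>2\<close>, so no row falls short by more than
    \<open>n * (c - d)\<close>. Taking a successor allows averaging over \<open>n\<close>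
    rounds.\<close>
  obtain n :: nat where n: "n > 0" "K < real n * (c - d)\<^sup>2"
  proof -
    obtain m :: nat where "K < real m * (c - d)\<^sup>2"
      using reals_Archimedean3[OF pos] by blast
    also have "\<dots> \<le> real (Suc m) * (c - d)\<^sup>2" by (intro mult_right_mono) auto
    finally show ?thesis using that[of "Suc m"] by simp
  qed
  obtain x where x: "\<forall>w\<in>W. 0 \<le> x w" "sum x W = real n"
    and bound: "(\<Sum>v\<in>V. (max 0 (c * real n - (\<Sum>w\<in>W. A v w * x w)))\<^sup>2) \<le> real n * K"
    using blackwell_approach[OF assms(1,2) response, of n] unfolding K_def by blast
  have "d * real n \<le> (\<Sum>w\<in>W. A v w * x w)" if "v \<in> V" for v
  proof -
    have "(max 0 (c * real n - (\<Sum>w\<in>W. A v w * x w)))\<^sup>2 \<le> real n * K"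
      using member_le_sum[OF that, of "\<lambda>v. (max 0 (c * real n - (\<Sum>w\<in>W. A v w * x w)))\<^sup>2"]
        \<open>finite V\<close> bound by fastforce
    also have "\<dots> \<le> real n * (real n * (c - d)\<^sup>2)"
      using n by (intro mult_left_mono) auto
    also have "\<dots> = (real n * (c - d))\<^sup>2" by (simp add: power2_eq_square)
    finally have "max 0 (c * real n - (\<Sum>w\<in>W. A v w * x w)) \<le> real n * (c - d)"
      by (rule power2_le_imp_le) (use \<open>d < c\<close> in simp)
    then show ?thesis by (simp add: algebra_simps)
  qed
  then have "\<forall>v\<in>V. d \<le> (\<Sum>w\<in>W. A v w * (x w / real n))"
    using n(1) by (simp add: sum_divide_distrib[symmetric] pos_le_divide_eq)
  moreover have "sum (\<lambda>w. x w / real n) W = 1"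
    using x n(1) by (simp add: sum_divide_distrib[symmetric])
  ultimately show ?thesis
    using x by (intro exI[of _ "\<lambda>w. x w / real n"]) auto
qed

section \<open>Fractional transversal numbers and complementary duality\<close>

lemma fractional_transversal_number_le:
  assumes "x \<in> fractional_transversals V E"
  shows "fractional_transversal_number V E \<le> sum x V"
  unfolding fractional_transversal_number_def
proof (rule cInf_lower)
  show "bdd_below ((\<lambda>x. sum x V) ` fractional_transversals V E)"
    by (rule bdd_belowI[of _ 0]) (auto simp: fractional_transversals_def intro: sum_nonneg)
qed (use assms in simp)

lemma fractional_transversal_number_ge:
  assumes "fractional_transversals V E \<noteq> {}"
    and "\<And>x. x \<in> fractional_transversals V E \<Longrightarrow> m \<le> sum x V"
  shows "m \<le> fractional_transversal_number V E"
  unfolding fractional_transversal_number_def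
  using assms by (intro cInf_greatest) auto

lemma one_le_sum_fractional_transversal:
  assumes "finite V" "x \<in> fractional_transversals V E" "e \<in># E" "e \<subseteq> V"
  shows "1 \<le> sum x V"
proof -
  have "1 \<le> sum x e" using assms by (simp add: fractional_transversals_def)
  also have "\<dots> \<le> sum x V"
    using assms by (intro sum_mono2) (auto simp: fractional_transversals_def)
  finally show ?thesis .
qed

text \<open>This feasible point keeps the infimum from being taken over the empty set.\<close>

lemma const_one_fractional_transversal:
  assumes "finite V" "\<And>e. e \<in># E \<Longrightarrow> e \<subseteq> V \<and> e \<noteq> {}"
  shows "(\<lambda>_. 1) \<in> fractional_transversals V E"
proof -
  have "1 \<le> card e" if "e \<in># E" for e
    using assms that by (metis One_nat_def Suc_leI card_gt_0_iff finite_subset)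
  then show ?thesis by (simp add: fractional_transversals_def)
qed

text \<open>The digraph is abstracted to an incidence relation and its transposed complement. Rows
  and columns get separate types to keep the two players apart; for a digraph both sets are the
  vertex set.\<close>

lemma fractional_transversal_number_complement_dual:
  fixes V :: "'a set" and W :: "'b set" and e :: "'a \<Rightarrow> 'b set" and f :: "'b \<Rightarrow> 'a set"
  assumes fin: "finite V" "finite W" and ne: "V \<noteq> {}" "W \<noteq> {}"
    and e: "\<And>v. v \<in> V \<Longrightarrow> e v \<subseteq> W \<and> e v \<noteq> {}"
    and f: "\<And>w. w \<in> W \<Longrightarrow> f w = {v \<in> V. w \<notin> e v} \<and> f w \<noteq> {}"
  shows "1 / fractional_transversal_number W (image_mset e (mset_set V))
       + 1 / fractional_transversal_number V (image_mset f (mset_set W)) = 1"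
proof -
  define P where "P = fractional_transversals W (image_mset e (mset_set V))"
  define Q where "Q = fractional_transversals V (image_mset f (mset_set W))"
  define a where "a = fractional_transversal_number W (image_mset e (mset_set V))"
  define b where "b = fractional_transversal_number V (image_mset f (mset_set W))"
  define M :: "'a \<Rightarrow> 'b \<Rightarrow> real" where "M v w = (if w \<in> e v then 1 else 0)" for v w
  have sum_e: "sum x (e v) = (\<Sum>w\<in>W. M v w * x w)" if "v \<in> V" for x v
  proof -
    have "sum x (e v) = sum x (W \<inter> e v)" using e[OF that] by (simp add: Int_absorb1)
    also have "\<dots> = (\<Sum>w\<in>W. if w \<in> e v then x w else 0)"
      using fin by (simp add: sum.inter_restrict)
    also have "\<dots> = (\<Sum>w\<in>W. M v w * x w)"
      by (intro sum.cong) (auto simp: M_def)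
    finally show ?thesis .
  qed
  have sum_f: "sum y (f w) = (\<Sum>v\<in>V. (1 - M v w) * y v)" if "w \<in> W" for y w
  proof -
    have "sum y (f w) = sum y (V \<inter> {v. w \<notin> e v})"
      using f[OF that] by (simp add: Collect_conj_eq Int_commute)
    also have "\<dots> = (\<Sum>v\<in>V. if w \<notin> e v then y v else 0)"
      using fin by (simp add: sum.inter_restrict)
    also have "\<dots> = (\<Sum>v\<in>V. (1 - M v w) * y v)"
      by (intro sum.cong) (auto simp: M_def)
    finally show ?thesis .
  qed
  have P: "x \<in> P \<longleftrightarrow> (\<forall>w\<in>W. 0 \<le> x w) \<and> (\<forall>v\<in>V. 1 \<le> (\<Sum>w\<in>W. M v w * x w))" for x
    using fin by (simp add: P_def fractional_transversals_def sum_e)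
  have Q: "y \<in> Q \<longleftrightarrow> (\<forall>v\<in>V. 0 \<le> y v) \<and> (\<forall>w\<in>W. 1 \<le> (\<Sum>v\<in>V. (1 - M v w) * y v))" for y
    using fin by (simp add: Q_def fractional_transversals_def sum_f)
  have "(\<lambda>_. 1) \<in> P"
    unfolding P_def using fin e by (intro const_one_fractional_transversal) auto
  then have P_ne: "P \<noteq> {}" by blast
  have f_sub: "f w \<subseteq> V \<and> f w \<noteq> {}" if "w \<in> W" for w
    using f[OF that] by (metis (no_types, lifting) mem_Collect_eq subsetI)
  have "(\<lambda>_. 1) \<in> Q"
    unfolding Q_def using fin f_sub by (intro const_one_fractional_transversal) auto
  then have Q_ne: "Q \<noteq> {}" by blast

  have P_ge1: "1 \<le> sum x W" if "x \<in> P" for x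
  proof -
    obtain v where "v \<in> V" using ne by blast
    then show ?thesis
      using one_le_sum_fractional_transversal[of W x _ "e v"] that fin e by (simp add: P_def)
  qed
  have Q_ge1: "1 \<le> sum y V" if "y \<in> Q" for y
  proof -
    obtain w where "w \<in> W" using ne by blast
    then show ?thesis
      using one_le_sum_fractional_transversal[of V y _ "f w"] that fin f_sub by (simp add: Q_def)
  qed
  \<comment> \<open>Double counting: \<open>M\<close> and \<open>1 - M\<close> split each product
    \<open>x w * y v\<close> between the two constraint systems. Divided by the right-hand side,
    this says that the reciprocals of the totals add up to at most 1.\<close>
  have weak: "sum x W + sum y V \<le> sum x W * sum y V" if "x \<in> P" "y \<in> Q" for x y
  proof -
    have "sum y V \<le> (\<Sum>v\<in>V. y v * (\<Sum>w\<in>W. M v w * x w))"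
    proof (rule sum_mono)
      fix v assume "v \<in> V"
      then show "y v \<le> y v * (\<Sum>w\<in>W. M v w * x w)"
        using that P Q mult_left_mono[of 1 "\<Sum>w\<in>W. M v w * x w" "y v"] by auto
    qed
    also have "\<dots> = (\<Sum>v\<in>V. \<Sum>w\<in>W. M v w * (x w * y v))"
      by (simp add: sum_distrib_left mult_ac)
    finally have 1: "sum y V \<le> (\<Sum>v\<in>V. \<Sum>w\<in>W. M v w * (x w * y v))" .
    have "sum x W \<le> (\<Sum>w\<in>W. x w * (\<Sum>v\<in>V. (1 - M v w) * y v))"
    proof (rule sum_mono)
      fix w assume "w \<in> W"
      then show "x w \<le> x w * (\<Sum>v\<in>V. (1 - M v w) * y v)"
        using that P Q mult_left_mono[of 1 "\<Sum>v\<in>V. (1 - M v w) * y v" "x w"] by auto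
    qed
    also have "\<dots> = (\<Sum>w\<in>W. \<Sum>v\<in>V. (1 - M v w) * (x w * y v))"
      by (simp add: sum_distrib_left mult_ac)
    also have "\<dots> = (\<Sum>v\<in>V. \<Sum>w\<in>W. (1 - M v w) * (x w * y v))"
      by (rule sum.swap)
    finally have "sum x W + sum y V
        \<le> (\<Sum>v\<in>V. \<Sum>w\<in>W. (1 - M v w) * (x w * y v)) + (\<Sum>v\<in>V. \<Sum>w\<in>W. M v w * (x w * y v))"
      using 1 by linarith
    also have "\<dots> = (\<Sum>v\<in>V. \<Sum>w\<in>W. x w * y v)"
      by (simp add: sum.distrib[symmetric] algebra_simps)
    also have "\<dots> = sum x W * sum y V"
      by (subst sum.swap) (simp add: sum_product)
    finally show ?thesis .
  qed
  \<comment> \<open>A total of exactly 1 would turn \<open>weak\<close> into s + 1 \<le> s.\<close>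
  have Q_gt1: "1 < sum y V" if "y \<in> Q" for y
  proof -
    obtain x where x: "x \<in> P" using P_ne by blast
    show ?thesis using weak[OF x that] Q_ge1[OF that] P_ge1[OF x] by (cases "sum y V = 1") auto
  qed
  have a_ge: "sum y V / (sum y V - 1) \<le> a" if "y \<in> Q" for y
    unfolding a_def
  proof (rule fractional_transversal_number_ge)
    fix x assume "x \<in> fractional_transversals W (image_mset e (mset_set V))"
    then show "sum y V / (sum y V - 1) \<le> sum x W"
      using weak[of x y] Q_gt1[OF that] that by (simp add: P_def divide_le_eq algebra_simps)
  qed (use P_ne in \<open>simp add: P_def\<close>)
  have a_gt1: "1 < a"
  proof -
    obtain y where y: "y \<in> Q" using Q_ne by blast
    have "1 < sum y V / (sum y V - 1)" using Q_gt1[OF y] by (simp add: less_divide_eq)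
    then show ?thesis using a_ge[OF y] by linarith
  qed
  \<comment> \<open>The map t / (t - 1) is a decreasing involution on t > 1, so \<open>a_ge\<close>
    inverts to a lower bound on every total in \<open>Q\<close>.\<close>
  have b_ge: "a / (a - 1) \<le> b"
    unfolding b_def
  proof (rule fractional_transversal_number_ge)
    fix y assume "y \<in> fractional_transversals V (image_mset f (mset_set W))"
    then have y: "y \<in> Q" by (simp add: Q_def)
    show "a / (a - 1) \<le> sum y V"
      using a_ge[OF y] Q_gt1[OF y] a_gt1 by (simp add: divide_le_eq algebra_simps)
  qed (use Q_ne in \<open>simp add: Q_def\<close>)

  \<comment> \<open>If no \<open>v\<close> responded, every edge \<open>e v\<close> would have
    weight above \<open>sum x W / a\<close>. Dividing \<open>x\<close> by the least edge weight
    \<open>m\<close> would then give a transversal of total below the infimum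
    \<open>a\<close>.\<close>
  have response: "\<forall>x. (\<forall>w\<in>W. 0 \<le> x w) \<longrightarrow>
    (\<exists>v\<in>V. (1 - 1 / a) * sum x W \<le> (\<Sum>w\<in>W. x w * (1 - M v w)))"
  proof (intro allI impI, rule ccontr)
    fix x
    assume x: "\<forall>w\<in>W. 0 \<le> x w"
      and no: "\<not> (\<exists>v\<in>V. (1 - 1 / a) * sum x W \<le> (\<Sum>w\<in>W. x w * (1 - M v w)))"
    then have less: "sum x W / a < (\<Sum>w\<in>W. M v w * x w)" if "v \<in> V" for v
    proof -
      have "(\<Sum>w\<in>W. x w * (1 - M v w)) < (1 - 1 / a) * sum x W"
        using no that by (auto simp: not_le)
      then show ?thesis
        by (simp add: left_diff_distrib right_diff_distrib sum_subtractf mult.commute)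
    qed
    define m where "m = Min ((\<lambda>v. \<Sum>w\<in>W. M v w * x w) ` V)"
    have m_le: "m \<le> (\<Sum>w\<in>W. M v w * x w)" if "v \<in> V" for v
      unfolding m_def using fin that by (intro Min_le) auto
    have "m \<in> (\<lambda>v. \<Sum>w\<in>W. M v w * x w) ` V"
      unfolding m_def using fin ne by (intro Min_in) auto
    then have m: "sum x W / a < m" using less by auto
    moreover have "0 \<le> sum x W / a" using x a_gt1 by (simp add: sum_nonneg)
    ultimately have m_pos: "0 < m" by linarith
    have "(\<lambda>w. x w / m) \<in> P"
      using x m_pos m_le by (simp add: P sum_divide_distrib[symmetric])
    then have "a \<le> (\<Sum>w\<in>W. x w / m)"
      unfolding a_def P_def by (rule fractional_transversal_number_le)
    then show False
      using m m_pos a_gt1 by (simp add: sum_divide_distrib[symmetric] field_simps)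
  qed
  \<comment> \<open>A mixed strategy guaranteeing \<open>d\<close> against \<open>1 - M\<close>
    becomes a transversal of total \<open>1 / d\<close> when divided by \<open>d\<close>.\<close>
  have b_le: "b \<le> 1 / d" if d: "0 < d" "d < 1 - 1 / a" for d
  proof -
    obtain y where y: "\<forall>v\<in>V. 0 \<le> y v" "sum y V = 1"
      "\<forall>w\<in>W. d \<le> (\<Sum>v\<in>V. (1 - M v w) * y v)"
      using approximate_minimax[OF fin(2,1) response d(2)] by blast
    have "(\<lambda>v. y v / d) \<in> Q"
      using y d by (simp add: Q sum_divide_distrib[symmetric])
    then have "b \<le> (\<Sum>v\<in>V. y v / d)"
      unfolding b_def Q_def by (rule fractional_transversal_number_le)
    then show ?thesis using y by (simp add: sum_divide_distrib[symmetric])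
  qed
  have b_pos: "0 < b"
  proof -
    have "0 < a / (a - 1)" using a_gt1 by simp
    then show ?thesis using b_ge by linarith
  qed
  \<comment> \<open>Minimax is available only strictly below the value, so the bound follows by
    density.\<close>
  have "1 - 1 / a \<le> 1 / b"
  proof (rule dense_le_bounded)
    show "0 < 1 - 1 / a" using a_gt1 by simp
    show "d \<le> 1 / b" if "0 < d" "d < 1 - 1 / a" for d
      using b_le[OF that] that b_pos by (simp add: field_simps)
  qed
  moreover have "1 / b \<le> 1 - 1 / a"
    using b_ge a_gt1 b_pos by (simp add: field_simps)
  ultimately show ?thesis by (simp add: a_def b_def)
qed

theorem theorem3:
  fixes D :: "'a pair_pre_digraph"
  assumes "pair_digraph D"
    and "pverts D \<noteq> {}"
    and "\<not> (\<exists>v\<in>pverts D. in_universal D v)"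
  shows "1 / fractional_in_dominating_number D
       + 1 / fractional_total_out_dominating_number (complement_digraph D) = 1"
proof -
  interpret pair_digraph D by fact
  have verts: "pverts (complement_digraph D) = pverts D"
    by (simp add: complement_digraph_def)
  have closed: "closed_in_nbhd D v \<subseteq> pverts D \<and> closed_in_nbhd D v \<noteq> {}" if "v \<in> pverts D" for v
    using that by (auto simp: closed_in_nbhd_def open_in_nbhd_def dest: in_arcsD1)
  \<comment> \<open>The vertex added in the closed neighbourhood matches the loop removed from the
    complement. Nonemptiness says that \<open>w\<close> is not in-universal.\<close>
  have open_out: "open_out_nbhd (complement_digraph D) w = {v \<in> pverts D. w \<notin> closed_in_nbhd D v}
      \<and> open_out_nbhd (complement_digraph D) w \<noteq> {}" if "w \<in> pverts D" for w
  proof -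
    have "open_out_nbhd (complement_digraph D) w = {v \<in> pverts D. w \<notin> closed_in_nbhd D v}"
      using that by (auto simp: open_out_nbhd_def complement_digraph_def closed_in_nbhd_def
        open_in_nbhd_def)
    moreover have "\<exists>v\<in>pverts D. w \<notin> closed_in_nbhd D v"
      using assms(3) that by (auto simp: in_universal_def)
    ultimately show ?thesis by auto
  qed
  show ?thesis
    unfolding fractional_in_dominating_number_def fractional_total_out_dominating_number_def verts
    by (rule fractional_transversal_number_complement_dual[OF pair_finite_verts pair_finite_verts
      assms(2,2) closed open_out])
qed

end
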